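(* Let $P=(\mathcal{X},\mathcal{D},\mathcal{C})$ be a constraint satisfaction problem with finite domains, and let $P_{dec}$ be the CSP obtained from $P$ by replacing every $\mathtt{alldifferent}$ constraint in $\mathcal{C}$ by the corresponding set of pairwise disequalities. Let $\Phi_{HA}(P)$ denote the result of achieving hyper-arc consistency on $P$ and $\Phi_{A}(P_{dec})$ the result of achieving arc consistency on $P_{dec}$. Then $$\Phi_{HA}(P)\preceq \Phi_{A}(P_{dec}).$$
   Context: A constraint satisfaction problem (CSP) $P=(\mathcal{X},\mathcal{D},\mathcal{C})$ consists of a finite set of variables $\mathcal{X}=\{x_1,\dots,x_n\}$, finite domains $\mathcal{D}=\{D_1,\dots,D_n\}$ (sets of values from a common universe) associated with them, and a finite set $\mathcal{C}$ of constraints, each on a subset of $\mathcal{X}$. A constraint on variables $x_{i_1},\dots,x_{i_m}$ (distinct) is a subset of $D_{i_1}\times\cdots\times D_{i_m}$; when domains are reduced, the constraint is restricted to the reduced domains. The constraint $\mathtt{alldifferent}(x_{i_1},\dots,x_{i_m})$ consists of all tuples with pairwise different entries; its decomposition is the set of binary constraints $x_{i_k}\neq x_{i_l}$ for $1\le k<l\le m$. A binary constraint $C(x_1,x_2)$ with $D_1,D_2$ non-empty is arc consistent iff for all $d_1\in D_1$ there is $d_2\in D_2$ with $(d_1,d_2)\in C$, and for all $d_2\in D_2$ there is $d_1\in D_1$ with $(d_1,d_2)\in C$. An $m$-ary constraint $C(x_1,\dots,x_m)$ with no $D_i$ empty is hyper-arc consistent iff for each $i$ and each $d_i\in D_i$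 there exist $d_j\in D_j$ for all $j\neq i$ such that $(d_1,\dots,d_m)\in C$. A CSP is arc consistent if all its binary constraints are arc consistent; it is hyper-arc consistent if all its constraints are hyper-arc consistent. Order: for CSPs on the same variables, with domains $D_i$ and $D_i'$ respectively (and possibly different constraints), $P\preceq P'$ means $D_i\subseteq D_i'$ for every $i$. A CSP with at least one empty domain is called failed; all failed CSPs are identified with a single object $P_\emptyset$, which by convention is the smallest CSP ($P_\emptyset\preceq P'$ for all $P'$). Achieving consistency: $\Phi_{HA}(P)$ (respectively $\Phi_A(P)$) is the largest, with respect to $\preceq$, CSP that has the same variables as $P$, non-empty domains contained in the corresponding domains of $P$, the constraints of $P$ (restricted to these domains), and is hyper-arc consistent (respectively arc consistent); if no such CSP exists, it is $P_\emptyset$. *)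

theory Defs
  imports Main
begin

text \<open>A constraint is a pair of its scope, a list of variables, and its set of tuples, each tuple
  being a list that gives the values in the order of the scope.\<close>

type_synonym ('v, 'a) constraint = "'v list \<times> 'a list set"

record ('v, 'a) csp =
  vars :: "'v set"
  doms :: "'v \<Rightarrow> 'a set"
  cons :: "('v, 'a) constraint set"

text \<open>The function \<open>doms\<close> is total; its value outside \<open>vars\<close> carries no information and is fixed to
  be empty, so that a CSP is determined by its variables, their domains and its constraints.\<close>

definition is_csp :: "('v, 'a) csp \<Rightarrow> bool" where
  "is_csp P \<longleftrightarrow>
     finite (vars P) \<and>
     (\<forall>x\<in>vars P. finite (doms P x)) \<and>
     (\<forall>x. x \<notin> vars P \<longrightarrow> doms P x = {}) \<and>
     finite (cons P) \<and>
     (\<forall>(xs, R)\<in>cons P. distinct xs \<and> set xs \<subseteq> vars P \<and> R \<subseteq> listset (map (doms P) xs))"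

definition restrict_constraint ::
    "('v \<Rightarrow> 'a set) \<Rightarrow> ('v, 'a) constraint \<Rightarrow> ('v, 'a) constraint" where
  "restrict_constraint D = (\<lambda>(xs, R). (xs, R \<inter> listset (map D xs)))"

definition alldifferent :: "('v \<Rightarrow> 'a set) \<Rightarrow> 'v list \<Rightarrow> ('v, 'a) constraint" where
  "alldifferent D xs = (xs, {t \<in> listset (map D xs). distinct t})"

definition disequality :: "('v \<Rightarrow> 'a set) \<Rightarrow> 'v \<Rightarrow> 'v \<Rightarrow> ('v, 'a) constraint" where
  "disequality D x y = ([x, y], {[a, b] | a b. a \<in> D x \<and> b \<in> D y \<and> a \<noteq> b})"

definition alldifferent_decomposition ::
    "('v \<Rightarrow> 'a set) \<Rightarrow> 'v list \<Rightarrow> ('v, 'a) constraint set" where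
  "alldifferent_decomposition D xs =
     {disequality D (xs ! k) (xs ! l) | k l. k < l \<and> l < length xs}"

text \<open>Constraints are sets of tuples, so a constraint counts as an alldifferent constraint
  exactly when it consists of the tuples over the current domains with pairwise different
  entries.\<close>

definition decompose :: "('v, 'a) csp \<Rightarrow> ('v, 'a) csp" where
  "decompose P = P\<lparr>cons :=
     {c \<in> cons P. \<nexists>xs. c = alldifferent (doms P) xs} \<union>
     (\<Union>xs\<in>{xs. alldifferent (doms P) xs \<in> cons P}. alldifferent_decomposition (doms P) xs)\<rparr>"

definition arc_consistent_constraint ::
    "('v \<Rightarrow> 'a set) \<Rightarrow> 'v \<Rightarrow> 'v \<Rightarrow> 'a list set \<Rightarrow> bool" where
  "arc_consistent_constraint D x y R \<longleftrightarrow>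
     D x \<noteq> {} \<and> D y \<noteq> {} \<and>
     (\<forall>a\<in>D x. \<exists>b\<in>D y. [a, b] \<in> R) \<and>
     (\<forall>b\<in>D y. \<exists>a\<in>D x. [a, b] \<in> R)"

definition hyper_arc_consistent_constraint ::
    "('v \<Rightarrow> 'a set) \<Rightarrow> ('v, 'a) constraint \<Rightarrow> bool" where
  "hyper_arc_consistent_constraint D = (\<lambda>(xs, R).
     (\<forall>x\<in>set xs. D x \<noteq> {}) \<and>
     (\<forall>i<length xs. \<forall>d\<in>D (xs ! i). \<exists>t\<in>listset (map D xs). t ! i = d \<and> t \<in> R))"

definition arc_consistent :: "('v, 'a) csp \<Rightarrow> bool" where
  "arc_consistent P \<longleftrightarrow>
     (\<forall>x y R. ([x, y], R) \<in> cons P \<longrightarrow> arc_consistent_constraint (doms P) x y R)"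

definition hyper_arc_consistent :: "('v, 'a) csp \<Rightarrow> bool" where
  "hyper_arc_consistent P \<longleftrightarrow> (\<forall>c\<in>cons P. hyper_arc_consistent_constraint (doms P) c)"

text \<open>CSPs up to identification of all failed ones: \<open>P_empty\<close> stands for every CSP with an empty
  domain, and \<open>Proper\<close> is meant for CSPs without empty domains only. Such a CSP is never below a
  failed one, as containment of its domains would make one of them empty.\<close>

datatype ('v, 'a) csp_object = P_empty | Proper "('v, 'a) csp"

fun csp_le :: "('v, 'a) csp_object \<Rightarrow> ('v, 'a) csp_object \<Rightarrow> bool" (infix "\<preceq>" 50) where
  "P_empty \<preceq> Q \<longleftrightarrow> True"
| "Proper P \<preceq> P_empty \<longleftrightarrow> False"
| "Proper P \<preceq> Proper Q \<longleftrightarrow> vars P = vars Q \<and> (\<forall>x\<in>vars P. doms P x \<subseteq> doms Q x)"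

definition consistent_reduction ::
    "(('v, 'a) csp \<Rightarrow> bool) \<Rightarrow> ('v, 'a) csp \<Rightarrow> ('v, 'a) csp \<Rightarrow> bool" where
  "consistent_reduction K P Q \<longleftrightarrow>
     is_csp Q \<and>
     vars Q = vars P \<and>
     (\<forall>x\<in>vars P. doms Q x \<noteq> {} \<and> doms Q x \<subseteq> doms P x) \<and>
     cons Q = restrict_constraint (doms Q) ` cons P \<and>
     K Q"

definition largest_consistent_reduction ::
    "(('v, 'a) csp \<Rightarrow> bool) \<Rightarrow> ('v, 'a) csp \<Rightarrow> ('v, 'a) csp \<Rightarrow> bool" where
  "largest_consistent_reduction K P Q \<longleftrightarrow>
     consistent_reduction K P Q \<and>
     (\<forall>Q'. consistent_reduction K P Q' \<longrightarrow> Proper Q' \<preceq> Proper Q)"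

definition achieve :: "(('v, 'a) csp \<Rightarrow> bool) \<Rightarrow> ('v, 'a) csp \<Rightarrow> ('v, 'a) csp_object" where
  "achieve K P =
     (if \<exists>Q. largest_consistent_reduction K P Q
      then Proper (THE Q. largest_consistent_reduction K P Q)
      else P_empty)"

definition Phi_HA :: "('v, 'a) csp \<Rightarrow> ('v, 'a) csp_object" where
  "Phi_HA = achieve hyper_arc_consistent"

definition Phi_A :: "('v, 'a) csp \<Rightarrow> ('v, 'a) csp_object" where
  "Phi_A = achieve arc_consistent"

end

theory Submission
  imports Defs
begin

text \<open>Restricting the decomposed CSP to the domains of a hyper-arc consistent reduction of \<open>P\<close> gives an
  arc consistent CSP, because a supporting tuple of an alldifferent constraint contains a support
  for each of its disequalities. Arc consistent reductions are closed under pointwise union of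
  domains, so a largest one exists as soon as there is one at all.\<close>

section \<open>Tuples over a product of domains, entry by entry\<close>

lemma listset_iff_list_all2: "t \<in> listset As \<longleftrightarrow> list_all2 (\<in>) t As"
proof (induction As arbitrary: t)
  case (Cons A As)
  then show ?case by (cases t) (auto simp: set_Cons_def)
qed simp

lemma in_listset_map_iff:
  "t \<in> listset (map D xs) \<longleftrightarrow> length t = length xs \<and> (\<forall>i<length xs. t ! i \<in> D (xs ! i))"
  by (auto simp: listset_iff_list_all2 list_all2_conv_all_nth)

section \<open>Restriction of a CSP to smaller domains\<close>

text \<open>Every consistent reduction of \<open>P\<close> has this form, with its own domains as
  \<open>D\<close>. Reductions can thus be treated as mere domain functions.\<close>

definition restrict_csp :: "('v \<Rightarrow> 'a set) \<Rightarrow> ('v, 'a) csp \<Rightarrow> ('v, 'a) csp" where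
  "restrict_csp D P = P\<lparr>doms := D, cons := restrict_constraint D ` cons P\<rparr>"

lemma restrict_csp_sel [simp]:
  "vars (restrict_csp D P) = vars P"
  "doms (restrict_csp D P) = D"
  "cons (restrict_csp D P) = restrict_constraint D ` cons P"
  by (simp_all add: restrict_csp_def)

text \<open>Containment is assumed at every \<open>x\<close>: outside \<open>vars P\<close> it
  forces \<open>D x\<close> to be empty, as \<open>is_csp\<close> demands.\<close>

lemma is_csp_restrict_csp:
  assumes "is_csp P" and "\<And>x. D x \<subseteq> doms P x"
  shows "is_csp (restrict_csp D P)"
  unfolding is_csp_def
proof (intro conjI ballI allI impI)
  show "finite (doms (restrict_csp D P) x)" if "x \<in> vars (restrict_csp D P)" for x
    using that assms(1) finite_subset[OF assms(2)] by (simp add: is_csp_def)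
  show "doms (restrict_csp D P) x = {}" if "x \<notin> vars (restrict_csp D P)" for x
    using that assms(1) assms(2)[of x] by (simp add: is_csp_def)
  show "case c of (xs, R) \<Rightarrow> distinct xs \<and> set xs \<subseteq> vars (restrict_csp D P) \<and>
          R \<subseteq> listset (map (doms (restrict_csp D P)) xs)"
    if "c \<in> cons (restrict_csp D P)" for c
    using that assms(1) by (auto simp: is_csp_def restrict_constraint_def)
qed (use assms(1) in \<open>simp_all add: is_csp_def\<close>)

lemma consistent_reduction_restrict_csp:
  assumes "is_csp P" and "\<And>x. D x \<subseteq> doms P x" and "\<And>x. x \<in> vars P \<Longrightarrow> D x \<noteq> {}"
    and "K (restrict_csp D P)"
  shows "consistent_reduction K P (restrict_csp D P)"
  using assms is_csp_restrict_csp[OF assms(1,2)] by (simp add: consistent_reduction_def)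

lemma consistent_reduction_doms_subset:
  assumes "consistent_reduction K P Q"
  shows "doms Q x \<subseteq> doms P x"
  using assms by (cases "x \<in> vars P") (auto simp: consistent_reduction_def is_csp_def)

section \<open>Uniqueness of the largest reduction\<close>

text \<open>Antisymmetry of \<open>\<preceq>\<close> gives equal domains on \<open>vars P\<close>,
  and off it both are empty; the domains then determine the constraints. This makes the description
  in \<open>achieve\<close> well defined.\<close>

lemma largest_consistent_reduction_unique:
  assumes "largest_consistent_reduction K P Q" and "largest_consistent_reduction K P Q'"
  shows "Q = Q'"
proof -
  have Q: "consistent_reduction K P Q" and Q': "consistent_reduction K P Q'"
    and le: "Proper Q \<preceq> Proper Q'" "Proper Q' \<preceq> Proper Q"
    using assms unfolding largest_consistent_reduction_def by blast+
  have doms: "doms Q = doms Q'"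
  proof
    fix x
    show "doms Q x = doms Q' x"
    proof (cases "x \<in> vars P")
      case True
      with Q Q' le show ?thesis
        unfolding consistent_reduction_def csp_le.simps by (metis subset_antisym)
    next
      case False
      with Q Q' show ?thesis unfolding consistent_reduction_def is_csp_def by metis
    qed
  qed
  show ?thesis
  proof (rule csp.equality)
    show "vars Q = vars Q'" using Q Q' unfolding consistent_reduction_def by metis
    show "cons Q = cons Q'" using Q Q' unfolding consistent_reduction_def doms by metis
  qed (simp_all add: doms)
qed

lemma achieve_eq_Proper:
  assumes "largest_consistent_reduction K P Q"
  shows "achieve K P = Proper Q"
proof -
  have "(THE Q. largest_consistent_reduction K P Q) = Q"
    using assms by (rule the_equality) (rule largest_consistent_reduction_unique[OF _ assms])
  with assms show ?thesis by (auto simp: achieve_def)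
qed

section \<open>Arc consistency and unions of domains\<close>

text \<open>Supports are sought among values of \<open>D\<close> anyway, so cutting a relation down
  to the product of these domains loses none of them. The unrestricted relations of \<open>P\<close>
  can then be kept fixed while domains vary.\<close>

lemma arc_consistent_restrict_csp_iff:
  "arc_consistent (restrict_csp D P) \<longleftrightarrow>
     (\<forall>x y R. ([x, y], R) \<in> cons P \<longrightarrow> arc_consistent_constraint D x y R)"
proof -
  have acc: "arc_consistent_constraint D x y (R \<inter> listset (map D [x, y])) \<longleftrightarrow>
        arc_consistent_constraint D x y R" for x y R
    by (auto simp: arc_consistent_constraint_def set_Cons_def)
  have in_cons: "([x, y], S) \<in> cons (restrict_csp D P) \<longleftrightarrow>
        (\<exists>R. ([x, y], R) \<in> cons P \<and> S = R \<inter> listset (map D [x, y]))" for x y S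
    by (simp add: restrict_constraint_def image_iff split_beta Bex_def
        del: listset.simps list.map)
  show ?thesis
    unfolding arc_consistent_def in_cons restrict_csp_sel(2)
    using acc by blast
qed

lemma consistent_reduction_restrict_cspD:
  assumes "consistent_reduction K P Q"
  shows "K (restrict_csp (doms Q) P)"
proof -
  have "Q = restrict_csp (doms Q) P"
    using assms unfolding consistent_reduction_def by (intro csp.equality) simp_all
  moreover have "K Q"
    using assms unfolding consistent_reduction_def by blast
  ultimately show ?thesis by (rule subst[where P = K])
qed

text \<open>A value of the union comes from one member of the family; its support there survives in
  the larger domains because \<open>R\<close> does not change.\<close>

lemma arc_consistent_constraint_Union:
  assumes "\<D> \<noteq> {}" and "\<And>D. D \<in> \<D> \<Longrightarrow> arc_consistent_constraint D x y R"
  shows "arc_consistent_constraint (\<lambda>z. \<Union>D\<in>\<D>. D z) x y R"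
proof -
  obtain D where D: "D \<in> \<D>" using assms(1) by blast
  show ?thesis
    unfolding arc_consistent_constraint_def
  proof (intro conjI ballI)
    show "(\<Union>D\<in>\<D>. D x) \<noteq> {}" "(\<Union>D\<in>\<D>. D y) \<noteq> {}"
      using D assms(2)[OF D] unfolding arc_consistent_constraint_def by blast+
    show "\<exists>b\<in>\<Union>D\<in>\<D>. D y. [a, b] \<in> R" if a: "a \<in> (\<Union>D\<in>\<D>. D x)" for a
    proof -
      obtain E where E: "E \<in> \<D>" "a \<in> E x" using a by blast
      then show ?thesis using assms(2)[OF E(1)] unfolding arc_consistent_constraint_def by blast
    qed
    show "\<exists>a\<in>\<Union>D\<in>\<D>. D x. [a, b] \<in> R" if b: "b \<in> (\<Union>D\<in>\<D>. D y)" for b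
    proof -
      obtain E where E: "E \<in> \<D>" "b \<in> E y" using b by blast
      then show ?thesis using assms(2)[OF E(1)] unfolding arc_consistent_constraint_def by blast
    qed
  qed
qed

lemma ex_largest_arc_consistent_reduction:
  assumes "is_csp P" and "consistent_reduction arc_consistent P Q0"
  shows "\<exists>Q. largest_consistent_reduction arc_consistent P Q"
proof -
  define \<D> where "\<D> = doms ` {Q. consistent_reduction arc_consistent P Q}"
  define U where "U = (\<lambda>x. \<Union>D\<in>\<D>. D x)"
  have doms_le: "doms Q x \<subseteq> U x" if "consistent_reduction arc_consistent P Q" for Q x
    using that by (auto simp: U_def \<D>_def)
  have "arc_consistent_constraint U x y R" if "([x, y], R) \<in> cons P" for x y R
    unfolding U_def
  proof (rule arc_consistent_constraint_Union)
    show "\<D> \<noteq> {}" using assms(2) by (auto simp: \<D>_def)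
    fix D assume "D \<in> \<D>"
    then obtain Q where Q: "consistent_reduction arc_consistent P Q" "D = doms Q"
      by (auto simp: \<D>_def)
    then have "arc_consistent (restrict_csp D P)"
      using consistent_reduction_restrict_cspD[OF Q(1)] by simp
    with that show "arc_consistent_constraint D x y R"
      by (simp add: arc_consistent_restrict_csp_iff)
  qed
  then have "arc_consistent (restrict_csp U P)"
    by (simp add: arc_consistent_restrict_csp_iff)
  moreover have "U x \<subseteq> doms P x" for x
    using consistent_reduction_doms_subset by (fastforce simp: U_def \<D>_def)
  \<comment> \<open>\<open>Q0\<close> is one of the reductions united in \<open>U\<close>, and its
    domains are non-empty.\<close>
  moreover have "U x \<noteq> {}" if "x \<in> vars P" for x
    using that assms(2) doms_le[OF assms(2), of x] by (auto simp: consistent_reduction_def)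
  ultimately have "consistent_reduction arc_consistent P (restrict_csp U P)"
    using assms(1) by (intro consistent_reduction_restrict_csp)
  moreover have "Proper Q \<preceq> Proper (restrict_csp U P)"
    if Q: "consistent_reduction arc_consistent P Q" for Q
  proof -
    have "vars Q = vars P" using Q unfolding consistent_reduction_def by blast
    with doms_le[OF Q] show ?thesis by simp
  qed
  ultimately show ?thesis
    unfolding largest_consistent_reduction_def by blast
qed

section \<open>The decomposed CSP\<close>

lemma decompose_sel [simp]: "vars (decompose P) = vars P" "doms (decompose P) = doms P"
  by (simp_all add: decompose_def)

lemma in_cons_decomposeE:
  assumes "c \<in> cons (decompose P)"
  obtains "c \<in> cons P"
  | xs k l where "alldifferent (doms P) xs \<in> cons P" "k < l" "l < length xs"
      "c = disequality (doms P) (xs ! k) (xs ! l)"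
  using assms by (auto simp: decompose_def alldifferent_decomposition_def)

lemma finite_alldifferent_decomposition: "finite (alldifferent_decomposition D xs)"
proof -
  have "alldifferent_decomposition D xs \<subseteq>
      (\<lambda>(k, l). disequality D (xs ! k) (xs ! l)) ` ({..<length xs} \<times> {..<length xs})"
    by (force simp: alldifferent_decomposition_def)
  then show ?thesis by (rule finite_subset) simp
qed

lemma is_csp_decompose:
  assumes "is_csp P"
  shows "is_csp (decompose P)"
proof -
  \<comment> \<open>An alldifferent constraint has \<open>xs\<close> itself as its first component,
    so these lists are among the finitely many scopes of \<open>P\<close>.\<close>
  have "finite {xs. alldifferent (doms P) xs \<in> cons P}"
  proof (rule finite_subset)
    show "{xs. alldifferent (doms P) xs \<in> cons P} \<subseteq> fst ` cons P"
      by (force simp: alldifferent_def)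
    show "finite (fst ` cons P)" using assms by (simp add: is_csp_def)
  qed
  then have "finite (cons (decompose P))"
    using assms by (simp add: decompose_def is_csp_def finite_alldifferent_decomposition)
  moreover have "case c of (ys, R) \<Rightarrow> distinct ys \<and> set ys \<subseteq> vars P \<and>
      R \<subseteq> listset (map (doms P) ys)" if "c \<in> cons (decompose P)" for c
    using that
  proof (cases rule: in_cons_decomposeE)
    case 1
    then show ?thesis using assms by (auto simp: is_csp_def)
  next
    case (2 xs k l)
    then have "distinct xs" "set xs \<subseteq> vars P"
      using assms by (auto simp: is_csp_def alldifferent_def)
    \<comment> \<open>Distinctness of the scope \<open>xs\<close> passes to the two-variable scope
      of the disequality.\<close>
    with 2 have "xs ! k \<noteq> xs ! l" "xs ! k \<in> vars P" "xs ! l \<in> vars P"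
      by (auto simp: nth_eq_iff_index_eq subset_iff)
    with 2 show ?thesis by (auto simp: disequality_def set_Cons_def)
  qed
  ultimately show ?thesis using assms by (auto simp: is_csp_def)
qed

section \<open>From hyper-arc consistency to arc consistency\<close>

lemma hyper_arc_consistent_constraint_support:
  assumes "hyper_arc_consistent_constraint D (xs, R)" and "i < length xs" and "d \<in> D (xs ! i)"
  obtains t where "t \<in> R" "t ! i = d" "length t = length xs" "\<forall>j<length xs. t ! j \<in> D (xs ! j)"
  using assms by (fastforce simp: hyper_arc_consistent_constraint_def in_listset_map_iff)

lemma hyper_arc_consistent_constraint_binary:
  assumes "hyper_arc_consistent_constraint D ([x, y], R)"
  shows "arc_consistent_constraint D x y R"
  unfolding arc_consistent_constraint_def
proof (intro conjI ballI)
  show "D x \<noteq> {}" "D y \<noteq> {}"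
    using assms by (simp_all add: hyper_arc_consistent_constraint_def)
  show "\<exists>b\<in>D y. [a, b] \<in> R" if a: "a \<in> D x" for a
  proof -
    obtain t where t: "t \<in> R" "t ! 0 = a" "length t = length [x, y]"
      and D: "\<forall>j<length [x, y]. t ! j \<in> D ([x, y] ! j)"
      by (rule hyper_arc_consistent_constraint_support[OF assms, of 0 a]) (use a in simp_all)
    \<comment> \<open>The supporting tuple has length two, so its other entry is the required
      support.\<close>
    have "t = [a, t ! 1]" using t by (cases t; cases "tl t") auto
    with t(1) D[rule_format, of 1] show ?thesis by (intro bexI[of _ "t ! 1"]) simp_all
  qed
  show "\<exists>a\<in>D x. [a, b] \<in> R" if b: "b \<in> D y" for b
  proof -
    obtain t where t: "t \<in> R" "t ! 1 = b" "length t = length [x, y]"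
      and D: "\<forall>j<length [x, y]. t ! j \<in> D ([x, y] ! j)"
      by (rule hyper_arc_consistent_constraint_support[OF assms, of 1 b]) (use b in simp_all)
    have "t = [t ! 0, b]" using t by (cases t; cases "tl t") auto
    with t(1) D[rule_format, of 0] show ?thesis by (intro bexI[of _ "t ! 0"]) simp_all
  qed
qed

text \<open>The relations are formed over the original domains \<open>D'\<close>, while supports are
  sought in the reduced \<open>D\<close>; \<open>sub\<close> bridges the two. Assuming only
  \<open>k \<noteq> l\<close> keeps the situation symmetric, so one support argument serves both
  directions.\<close>

lemma hyper_arc_consistent_constraint_alldifferent:
  assumes hac: "hyper_arc_consistent_constraint D (alldifferent D' xs)"
    and sub: "\<And>x. D x \<subseteq> D' x"
    and kl: "k < length xs" "l < length xs" "k \<noteq> l"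
    and diseq: "disequality D' (xs ! k) (xs ! l) = ([x, y], R)"
  shows "arc_consistent_constraint D x y R"
proof -
  have xy: "x = xs ! k" "y = xs ! l" "R = {[a, b] | a b. a \<in> D' x \<and> b \<in> D' y \<and> a \<noteq> b}"
    using diseq by (auto simp: disequality_def)
  have support: "\<exists>b\<in>D (xs ! j). b \<noteq> a"
    if ij: "i < length xs" "j < length xs" "i \<noteq> j" "a \<in> D (xs ! i)" for i j a
  proof -
    obtain t where t: "t \<in> {t \<in> listset (map D' xs). distinct t}" "t ! i = a"
        "length t = length xs" and D: "\<forall>j<length xs. t ! j \<in> D (xs ! j)"
      by (rule hyper_arc_consistent_constraint_support[OF hac[unfolded alldifferent_def] ij(1,4)])
    \<comment> \<open>Entries of an alldifferent tuple at distinct positions differ, so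
      \<open>t ! j\<close> supports \<open>a\<close>.\<close>
    have "t ! j \<noteq> t ! i"
      using t(1,3) ij(1-3) by (simp add: nth_eq_iff_index_eq)
    with t(2) D[rule_format, OF ij(2)] show ?thesis by blast
  qed
  show ?thesis
    unfolding arc_consistent_constraint_def
  proof (intro conjI ballI)
    show "D x \<noteq> {}" "D y \<noteq> {}"
      using hac kl(1,2) by (simp_all add: hyper_arc_consistent_constraint_def alldifferent_def xy(1,2))
    show "\<exists>b\<in>D y. [a, b] \<in> R" if "a \<in> D x" for a
    proof -
      have "\<exists>b\<in>D y. b \<noteq> a"
        using support[OF kl] that by (simp add: xy(1,2))
      with that sub show ?thesis unfolding xy(3) by blast
    qed
    show "\<exists>a\<in>D x. [a, b] \<in> R" if "b \<in> D y" for b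
    proof -
      have "\<exists>a\<in>D x. a \<noteq> b"
        using support[OF kl(2,1) kl(3)[symmetric]] that by (simp add: xy(1,2))
      with that sub show ?thesis unfolding xy(3) by blast
    qed
  qed
qed

text \<open>A supporting tuple already lies in the product of the domains \<open>D\<close>, so the
  restriction never discards it.\<close>

lemma hyper_arc_consistent_restrict_csp_iff:
  "hyper_arc_consistent (restrict_csp D P) \<longleftrightarrow>
     (\<forall>c\<in>cons P. hyper_arc_consistent_constraint D c)"
proof -
  have "hyper_arc_consistent_constraint D (restrict_constraint D c) \<longleftrightarrow>
        hyper_arc_consistent_constraint D c" for c
    by (cases c) (auto simp: hyper_arc_consistent_constraint_def restrict_constraint_def)
  then show ?thesis by (simp add: hyper_arc_consistent_def)
qed

lemma arc_consistent_restrict_decompose: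
  assumes "hyper_arc_consistent (restrict_csp D P)" and "\<And>x. D x \<subseteq> doms P x"
  shows "arc_consistent (restrict_csp D (decompose P))"
  unfolding arc_consistent_restrict_csp_iff
proof (intro allI impI)
  fix x y R
  assume "([x, y], R) \<in> cons (decompose P)"
  then show "arc_consistent_constraint D x y R"
  proof (cases rule: in_cons_decomposeE)
    case 1
    then show ?thesis
      using assms(1)
      by (auto simp: hyper_arc_consistent_restrict_csp_iff
          intro: hyper_arc_consistent_constraint_binary)
  next
    case (2 xs k l)
    have "hyper_arc_consistent_constraint D (alldifferent (doms P) xs)"
      using assms(1) 2(1) by (simp add: hyper_arc_consistent_restrict_csp_iff)
    from this assms(2) show ?thesis
      by (rule hyper_arc_consistent_constraint_alldifferent[where k = k and l = l])
        (use 2 in simp_all)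
  qed
qed

section \<open>Comparison of the two results\<close>

theorem proposition2:
  fixes P :: "('v, 'a) csp"
  assumes "is_csp P"
  shows "Phi_HA P \<preceq> Phi_A (decompose P)"
proof (cases "\<exists>Q. largest_consistent_reduction hyper_arc_consistent P Q")
  case True
  then obtain Q where Q: "largest_consistent_reduction hyper_arc_consistent P Q" by blast
  then have red: "consistent_reduction hyper_arc_consistent P Q"
    unfolding largest_consistent_reduction_def by blast
  \<comment> \<open>\<open>Q'\<close> has the domains of \<open>Q\<close> but the constraints of the
    decomposition. As an arc consistent reduction it shows that \<open>Phi_A\<close> does not
    fail.\<close>
  define Q' where "Q' = restrict_csp (doms Q) (decompose P)"
  have Q': "consistent_reduction arc_consistent (decompose P) Q'"
    unfolding Q'_def
  proof (rule consistent_reduction_restrict_csp[OF is_csp_decompose[OF assms]])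
    show "doms Q x \<subseteq> doms (decompose P) x" for x
      using consistent_reduction_doms_subset[OF red] by simp
    show "doms Q x \<noteq> {}" if "x \<in> vars (decompose P)" for x
      using that red unfolding consistent_reduction_def by simp
    show "arc_consistent (restrict_csp (doms Q) (decompose P))"
      using consistent_reduction_restrict_cspD[OF red] consistent_reduction_doms_subset[OF red]
      by (rule arc_consistent_restrict_decompose)
  qed
  then obtain S where S: "largest_consistent_reduction arc_consistent (decompose P) S"
    using ex_largest_arc_consistent_reduction[OF is_csp_decompose[OF assms]] by blast
  with Q' have "Proper Q' \<preceq> Proper S"
    unfolding largest_consistent_reduction_def by blast
  moreover have "vars Q = vars P"
    using red unfolding consistent_reduction_def by blast
  \<comment> \<open>The order compares only variables and domains, which \<open>Q\<close> and
    \<open>Q'\<close> share.\<close>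
  ultimately have "Proper Q \<preceq> Proper S"
    by (simp add: Q'_def)
  then show ?thesis
    unfolding Phi_HA_def Phi_A_def achieve_eq_Proper[OF Q] achieve_eq_Proper[OF S] .
next
  \<comment> \<open>Here \<open>Phi_HA P\<close> is \<open>P_empty\<close>, which lies below
    everything.\<close>
  case False
  then show ?thesis by (simp add: Phi_HA_def achieve_def)
qed

end
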